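(* Let $\theta\neq 0$ be the true parameter, let $(\hat\theta_n)_{n\ge1}$ be a sequence of real-valued estimators of $\theta$, and let $R_\theta$ be the surrogate reward function. Suppose that the estimators satisfy, as $n\to\infty$: - $\sigma_n^2:=\mathbb{E}[(\hat\theta_n-\theta)^2]$ satisfies $\lim_{n\to\infty}n\sigma_n^2=\sigma_\theta^2$ for some constant $\sigma_\theta^2>0$; - $|\mathbb{E}[\hat\theta_n-\theta]|=o(n^{-1})$; - $\mathbb{E}[|\hat\theta_n-\theta|^k]=O(n^{-k/2})$ for $k=3,4,\dots$. Suppose also that, for any true parameter $\theta$ in its domain, the surrogate reward satisfies: - $R^{(1)}_\theta(\theta)=0$ and $R^{(2)}_\theta(\theta)<0$; - there exists a constant $C$, independent of $\theta$, such that $R^{(3)}_\theta(\theta)/R^{(2)}_\theta(\theta)=C/\theta$; - $|R^{(5)}_\theta(x)|\le M$ for some constant $M$ and for all $x$ on the interval between $\theta$ and $\hat\theta_n$ (this implicitly assumes the existence of all derivatives up to order five). Let $$\lambda^\ast=-\frac{(C+2)\sigma_\theta^2}{2\theta^2}.$$ Then $$\lim_{n\to\infty} n^2\left(\mathbb{E}\left[R_{\theta}\left(\hat\theta_n\left(1+\frac{\lambda^\ast}{n}\right)\right)\right]-\mathbb{E}[R_{\theta}(\hat\theta_n)]\right)=-\frac{R^{(2)}_{\theta}(\theta)(C+2)^2\sigma_\theta^4}{8\theta^2}\ge 0.$$ Moreover, this choice of $\lambda^\ast$ is optimal in the following sense: among all adjustment coefficients of the form $\lambda=k\,\sigma_\theta^2/\theta^2$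 with $k\in\mathbb{R}$ a constant, $k=-(C+2)/2$ is the unique constant that maximizes the asymptotic improvement $$\lim_{n\to\infty} n^2\left(\mathbb{E}\left[R_{\theta}\left(\hat\theta_n\left(1+\frac{\lambda}{n}\right)\right)\right]-\mathbb{E}[R_{\theta}(\hat\theta_n)]\right)$$ for all valid $(\theta,\sigma_\theta)$ (i.e. all those satisfying the conditions listed above with the given $C$).
   Context: $\theta$ is an unknown scalar parameter and $\hat\theta_n$ is an estimator of $\theta$ computed from a dataset of size $n$; expectations are over the sampling distribution of $\hat\theta_n$. The surrogate reward is a real-valued function $R_\theta(\cdot)$ of the estimate (it arises as $R_\theta(\hat\theta)=F(z(\hat\theta),\theta)$, where $F(z,\theta)$ is the reward of decision $z$ and $z(\theta)=\arg\max_z F(z,\theta)$). $R_\theta^{(k)}(x)$ denotes the $k$-th derivative of $R_\theta(x)$ with respect to its argument $x$. The coefficient $\lambda$ does not depend on $n$; $\lambda=0$ corresponds to the unadjusted estimator. *)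

theory Defs
  imports "HOL-Probability.Probability" "HOL-Library.Landau_Symbols"
begin

(* Th is the domain of true parameters. D th is the open interval on which the reward x |-> R th x
   is a genuine function of the estimate (e.g. {0<..} for rewards with a singularity at 0);
   HOL functions being total, the values of R th outside D th are irrelevant.
   The real number C is the same for all th. *)
definition regular_reward ::
  "real set \<Rightarrow> (real \<Rightarrow> real set) \<Rightarrow> (real \<Rightarrow> real \<Rightarrow> real) \<Rightarrow> real \<Rightarrow> bool" where
  "regular_reward Th D R C \<longleftrightarrow>
     (\<forall>\<theta>\<in>Th. \<theta> \<noteq> 0 \<and>
        open (D \<theta>) \<and> is_interval (D \<theta>) \<and> \<theta> \<in> D \<theta> \<and>
        (\<forall>j<5. \<forall>x\<in>D \<theta>. (deriv ^^ j) (R \<theta>) field_differentiable (at x)) \<and>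
        deriv (R \<theta>) \<theta> = 0 \<and>
        (deriv ^^ 2) (R \<theta>) \<theta> < 0 \<and>
        (deriv ^^ 3) (R \<theta>) \<theta> / (deriv ^^ 2) (R \<theta>) \<theta> = C / \<theta>)"

(* T n is the estimator computed from n observations and P n the probability space underlying its
   sampling distribution. The moments are required to exist explicitly (for large n), because the
   Bochner integral of a non-integrable function is 0. *)
definition estimator_sequence ::
  "real \<Rightarrow> real \<Rightarrow> (nat \<Rightarrow> 'w measure) \<Rightarrow> (nat \<Rightarrow> 'w \<Rightarrow> real) \<Rightarrow> bool" where
  "estimator_sequence \<theta> \<sigma> P T \<longleftrightarrow>
     (\<forall>n\<ge>1. prob_space (P n) \<and> T n \<in> borel_measurable (P n)) \<and>
     (\<forall>k. \<forall>\<^sub>F n in sequentially. integrable (P n) (\<lambda>\<omega>. \<bar>T n \<omega> - \<theta>\<bar> ^ k)) \<and>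
     \<sigma> > 0 \<and>
     (\<lambda>n. real n * (\<integral>\<omega>. (T n \<omega> - \<theta>)\<^sup>2 \<partial>P n)) \<longlonglongrightarrow> \<sigma>\<^sup>2 \<and>
     (\<lambda>n. \<bar>\<integral>\<omega>. (T n \<omega> - \<theta>) \<partial>P n\<bar>) \<in> o(\<lambda>n. 1 / real n) \<and>
     (\<forall>k\<ge>3. (\<lambda>n. \<integral>\<omega>. \<bar>T n \<omega> - \<theta>\<bar> ^ k \<partial>P n) \<in> O(\<lambda>n. real n powr (- real k / 2)))"

(* The first two clauses only say that r (the reward at the true parameter, with domain E) is
   evaluated inside its domain; for the adjusted estimators this is needed for large n only.
   Both are void for E = UNIV. *)
definition compatible ::
  "real \<Rightarrow> real set \<Rightarrow> (real \<Rightarrow> real) \<Rightarrow> (nat \<Rightarrow> 'w measure) \<Rightarrow> (nat \<Rightarrow> 'w \<Rightarrow> real) \<Rightarrow> bool" where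
  "compatible \<theta> E r P T \<longleftrightarrow>
     (\<forall>n\<ge>1. \<forall>\<omega>\<in>space (P n). T n \<omega> \<in> E) \<and>
     (\<forall>l. \<forall>\<^sub>F n in sequentially. \<forall>\<omega>\<in>space (P n). T n \<omega> * (1 + l / real n) \<in> E) \<and>
     (\<exists>M. \<forall>n\<ge>1. \<forall>\<omega>\<in>space (P n). \<forall>x\<in>closed_segment \<theta> (T n \<omega>). \<bar>(deriv ^^ 5) r x\<bar> \<le> M)"

definition valid ::
  "real set \<Rightarrow> (real \<Rightarrow> real set) \<Rightarrow> (real \<Rightarrow> real \<Rightarrow> real) \<Rightarrow> real \<Rightarrow> real
    \<Rightarrow> (nat \<Rightarrow> 'w measure) \<Rightarrow> (nat \<Rightarrow> 'w \<Rightarrow> real) \<Rightarrow> bool" where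
  "valid Th D R \<theta> \<sigma> P T \<longleftrightarrow>
     \<theta> \<in> Th \<and> estimator_sequence \<theta> \<sigma> P T \<and> compatible \<theta> (D \<theta>) (R \<theta>) P T"

definition scaled_improvement ::
  "(real \<Rightarrow> real) \<Rightarrow> (nat \<Rightarrow> 'w measure) \<Rightarrow> (nat \<Rightarrow> 'w \<Rightarrow> real) \<Rightarrow> real \<Rightarrow> nat \<Rightarrow> real" where
  "scaled_improvement r P T l n =
     (real n)\<^sup>2 * ((\<integral>\<omega>. r (T n \<omega> * (1 + l / real n)) \<partial>P n) - (\<integral>\<omega>. r (T n \<omega>) \<partial>P n))"

definition maximizes_improvement ::
  "(real \<Rightarrow> real) \<Rightarrow> real \<Rightarrow> real \<Rightarrow> (nat \<Rightarrow> 'w measure) \<Rightarrow> (nat \<Rightarrow> 'w \<Rightarrow> real) \<Rightarrow> real \<Rightarrow> bool" where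
  "maximizes_improvement r \<theta> \<sigma> P T k \<longleftrightarrow>
     (\<forall>k'. convergent (scaled_improvement r P T (k' * \<sigma>\<^sup>2 / \<theta>\<^sup>2))) \<and>
     is_arg_max (\<lambda>k'. lim (scaled_improvement r P T (k' * \<sigma>\<^sup>2 / \<theta>\<^sup>2))) (\<lambda>_. True) k"

end

theory Submission
  imports Defs
begin

text \<open>
  Subtract from the reward its cubic Taylor polynomial at \<open>\<theta>\<close>. The derivative of the remainder is
  \<open>O(\<bar>z - \<theta>\<bar>\<^sup>3 (1 + \<bar>z - \<theta>\<bar>))\<close>, so by the mean value theorem the remainder changes under the adjustment
  \<open>x \<mapsto> x (1 + l / n)\<close> by \<open>l / n\<close> times a quantity whose expectation is \<open>o(1 / n)\<close>. The cubic
  polynomial changes by an explicit polynomial in \<open>x - \<theta>\<close>; taking expectations, only the terms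
  \<open>a l\<^sup>2 \<theta>\<^sup>2 / 2 + l \<sigma>\<^sup>2 (a + \<theta> b / 2)\<close> survive multiplication by \<open>n\<^sup>2\<close>, where \<open>a\<close> and \<open>b\<close> are the
  second and third derivatives at \<open>\<theta>\<close>. With \<open>b = C a / \<theta>\<close> this is a concave quadratic in \<open>l\<close>, and
  completing the square gives the maximizer.

  The bound on the fifth derivative covers the segments to the estimates only, while the adjusted
  estimates may lie outside. All the argument needs is that the fourth derivative grows at most
  linearly on the segments to the adjusted estimates for large \<open>n\<close>.
\<close>

section \<open>Taylor estimates for the reward at its critical point\<close>

text \<open>Here \<open>g j\<close> stands for the j-th derivative of one function. Expanding
  \<open>g 1\<close> to order three about \<open>\<theta>\<close> leaves the Lagrange term
  \<open>g 4 t / 6 * (z - \<theta>) ^ 3\<close>. As \<open>t\<close> lies between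
  \<open>\<theta>\<close> and \<open>z\<close>, the growth bound at \<open>t\<close> is at most the
  one at \<open>z\<close>; the factor 1/6 is given away.\<close>

lemma deriv_cubic_remainder:
  fixes g :: "nat \<Rightarrow> real \<Rightarrow> real"
  assumes der: "\<And>j x. j < 4 \<Longrightarrow> x \<in> closed_segment \<theta> z \<Longrightarrow> (g j has_real_derivative g (Suc j) x) (at x)"
    and crit: "g 1 \<theta> = 0"
    and growth: "\<And>x. x \<in> closed_segment \<theta> z \<Longrightarrow> \<bar>g 4 x\<bar> \<le> A * (1 + \<bar>x - \<theta>\<bar>)"
  shows "\<bar>g 1 z - (g 2 \<theta> * (z - \<theta>) + g 3 \<theta> * (z - \<theta>)\<^sup>2 / 2)\<bar> \<le> A * (1 + \<bar>z - \<theta>\<bar>) * \<bar>z - \<theta>\<bar> ^ 3"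
\<comment> \<open>\<open>Taylor\<close> needs \<open>z\<close> to differ from the centre
  \<open>\<theta>\<close>; at \<open>z = \<theta>\<close> both sides vanish by
  \<open>crit\<close>.\<close>
proof (cases "z = \<theta>")
  case True
  then show ?thesis using crit by simp
next
  case False
  have A: "0 \<le> A"
    using growth[of \<theta>] by auto
  have seg: "closed_segment \<theta> z = {min \<theta> z..max \<theta> z}"
    by (auto simp: closed_segment_eq_real_ivl)
  have "\<exists>t. (if z < \<theta> then z < t \<and> t < \<theta> else \<theta> < t \<and> t < z) \<and>
      g 1 z = (\<Sum>m<3. g (Suc m) \<theta> / fact m * (z - \<theta>) ^ m) + g (Suc 3) t / fact 3 * (z - \<theta>) ^ 3"
    by (rule Taylor[of 3 "\<lambda>m. g (Suc m)" "g 1" "min \<theta> z" "max \<theta> z"])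
      (use False der seg in auto)
  then obtain t where t: "if z < \<theta> then z < t \<and> t < \<theta> else \<theta> < t \<and> t < z"
    and eq: "g 1 z = (\<Sum>m<3. g (Suc m) \<theta> / fact m * (z - \<theta>) ^ m) + g (Suc 3) t / fact 3 * (z - \<theta>) ^ 3"
    by blast
  have "g 1 z - (g 2 \<theta> * (z - \<theta>) + g 3 \<theta> * (z - \<theta>)\<^sup>2 / 2) = g 4 t / 6 * (z - \<theta>) ^ 3"
    using eq crit by (simp add: eval_nat_numeral)
  then have "\<bar>g 1 z - (g 2 \<theta> * (z - \<theta>) + g 3 \<theta> * (z - \<theta>)\<^sup>2 / 2)\<bar> = \<bar>g 4 t\<bar> / 6 * \<bar>z - \<theta>\<bar> ^ 3"
    by (simp only: abs_mult power_abs abs_divide abs_numeral)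
  also have "\<dots> \<le> (A * (1 + \<bar>z - \<theta>\<bar>)) * \<bar>z - \<theta>\<bar> ^ 3"
  proof (rule mult_right_mono)
    have "\<bar>g 4 t\<bar> \<le> A * (1 + \<bar>t - \<theta>\<bar>)"
      by (rule growth) (use t in \<open>auto simp: seg split: if_splits\<close>)
    also have "\<dots> \<le> A * (1 + \<bar>z - \<theta>\<bar>)"
      by (rule mult_left_mono) (use t A in \<open>auto split: if_splits\<close>)
    finally show "\<bar>g 4 t\<bar> / 6 \<le> A * (1 + \<bar>z - \<theta>\<bar>)" by linarith
  qed simp
  finally show ?thesis .
qed

text \<open>The mean value theorem is applied between \<open>x\<close> and \<open>y\<close> to the
  function minus its cubic Taylor polynomial. This keeps the factor
  \<open>\<bar>y - x\<bar>\<close>, which is of order 1/n for an adjusted estimate; bounding the two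
  Taylor remainders separately would lose it.\<close>

lemma cubic_taylor_increment:
  fixes g :: "nat \<Rightarrow> real \<Rightarrow> real"
  assumes der: "\<And>j z. j < 4 \<Longrightarrow> z \<in> closed_segment \<theta> x \<union> closed_segment \<theta> y
      \<Longrightarrow> (g j has_real_derivative g (Suc j) z) (at z)"
    and crit: "g 1 \<theta> = 0"
    and growth: "\<And>z. z \<in> closed_segment \<theta> x \<union> closed_segment \<theta> y \<Longrightarrow> \<bar>g 4 z\<bar> \<le> A * (1 + \<bar>z - \<theta>\<bar>)"
    and w: "\<bar>x - \<theta>\<bar> \<le> w" "\<bar>y - \<theta>\<bar> \<le> w"
  shows "\<bar>g 0 y - g 0 x - (g 2 \<theta> / 2 * ((y - \<theta>)\<^sup>2 - (x - \<theta>)\<^sup>2) + g 3 \<theta> / 6 * ((y - \<theta>) ^ 3 - (x - \<theta>) ^ 3))\<bar>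
    \<le> A * (1 + w) * w ^ 3 * \<bar>y - x\<bar>"
proof -
  define h where "h z = g 0 z - (g 2 \<theta> / 2 * (z - \<theta>)\<^sup>2 + g 3 \<theta> / 6 * (z - \<theta>) ^ 3)" for z
  define h' where "h' z = g 1 z - (g 2 \<theta> * (z - \<theta>) + g 3 \<theta> * (z - \<theta>)\<^sup>2 / 2)" for z
  have A: "0 \<le> A"
    using growth[of \<theta>] by auto
  \<comment> \<open>This covering holds whether or not \<open>\<theta>\<close> lies between
    \<open>x\<close> and \<open>y\<close>, so all hypotheses are available along the path from
    \<open>x\<close> to \<open>y\<close>.\<close>
  have seg: "closed_segment x y \<subseteq> closed_segment \<theta> x \<union> closed_segment \<theta> y"
    by (auto simp: closed_segment_eq_real_ivl split: if_splits)
  have "norm (h y - h x) \<le> (A * (1 + w) * w ^ 3) * norm (y - x)"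
  proof (rule field_differentiable_bound[where S = "closed_segment x y" and f' = h'])
    fix z assume z: "z \<in> closed_segment x y"
    have "((\<lambda>z. g 0 z - (g 2 \<theta> / 2 * (z - \<theta>)\<^sup>2 + g 3 \<theta> / 6 * (z - \<theta>) ^ 3)) has_real_derivative h' z) (at z)"
      unfolding h'_def using der[of 0 z] z seg
      by (auto intro!: derivative_eq_intros simp: power2_eq_square field_simps)
    then show "(h has_field_derivative h' z) (at z within closed_segment x y)"
      unfolding h_def by (rule has_field_derivative_at_within)
    have zw: "\<bar>z - \<theta>\<bar> \<le> w"
      using z w by (auto simp: closed_segment_eq_real_ivl split: if_splits)
    have sub: "closed_segment \<theta> z \<subseteq> closed_segment \<theta> x \<union> closed_segment \<theta> y"
      using z by (auto simp: closed_segment_eq_real_ivl split: if_splits)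
    have "\<bar>h' z\<bar> \<le> A * (1 + \<bar>z - \<theta>\<bar>) * \<bar>z - \<theta>\<bar> ^ 3"
      unfolding h'_def using sub by (intro deriv_cubic_remainder crit der growth) auto
    also have "\<dots> \<le> A * (1 + w) * w ^ 3"
      by (intro mult_mono power_mono) (use zw A in auto)
    finally show "norm (h' z) \<le> A * (1 + w) * w ^ 3" by simp
  qed auto
  then show ?thesis
    by (simp add: h_def algebra_simps)
qed

lemma add_power3_le:
  fixes a b :: real
  assumes "0 \<le> a" "0 \<le> b"
  shows "(a + b) ^ 3 \<le> 4 * (a ^ 3 + b ^ 3)"
proof -
  have "4 * (a ^ 3 + b ^ 3) - (a + b) ^ 3 = 3 * ((a + b) * (a - b)\<^sup>2)"
    by (simp add: eval_nat_numeral algebra_simps)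
  then show ?thesis using assms
    by (smt (verit) mult_nonneg_nonneg zero_le_power2)
qed

text \<open>Used with \<open>a\<close> = |\<theta>|, \<open>u\<close> = |x - \<theta>|,
  \<open>v\<close> = |x| and \<open>t\<close> = |s|, where s is the relative adjustment. The bound
  splits into terms that carry \<open>t\<close> together with at least the third power of
  \<open>u\<close>, and terms that carry \<open>t ^ 4\<close>. With \<open>t\<close> of order 1/n,
  both kinds have expectation o(1/n^2).\<close>

lemma remainder_polynomial_le:
  fixes a t u v w :: real
  assumes "0 \<le> a" "0 \<le> u" "0 \<le> t" "t \<le> 1" "0 \<le> v" "v \<le> a + u" and w: "w = u + t * v"
  shows "(1 + w) * w ^ 3 * (t * v) \<le> 64 * (1 + a) ^ 5 * (t * ((1 + u\<^sup>2) * (u ^ 3 + t ^ 3 * (1 + u ^ 3))))"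
proof -
  have v: "v \<le> (1 + a) * (1 + u)"
    using assms by (simp add: algebra_simps) (smt (verit) mult_nonneg_nonneg)
  have tv: "t * v \<le> v" "0 \<le> t * v"
    using assms by (auto simp: mult_left_le_one_le)
  have "0 \<le> a * u" using assms by simp
  then have w1: "1 + w \<le> 2 * (1 + a) * (1 + u)"
    using tv assms unfolding distrib_left distrib_right by linarith
  have v3: "v ^ 3 \<le> (1 + a) ^ 3 * (4 * (1 + u ^ 3))"
  proof -
    have "v ^ 3 \<le> ((1 + a) * (1 + u)) ^ 3"
      using v assms by (intro power_mono) auto
    also have "\<dots> = (1 + a) ^ 3 * (1 + u) ^ 3" by (rule power_mult_distrib)
    also have "\<dots> \<le> (1 + a) ^ 3 * (4 * (1 + u ^ 3))"
      using add_power3_le[of 1 u] assms by (intro mult_left_mono) auto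
    finally show ?thesis .
  qed
  have w3: "w ^ 3 \<le> 16 * (1 + a) ^ 3 * (u ^ 3 + t ^ 3 * (1 + u ^ 3))"
  proof -
    have "w ^ 3 \<le> 4 * (u ^ 3 + t ^ 3 * v ^ 3)"
      using add_power3_le[of u "t * v"] assms tv by (simp add: power_mult_distrib)
    \<comment> \<open>The first summand is enlarged on purpose, so that both summands share the
      factor \<open>4 * (1 + a) ^ 3\<close>.\<close>
    also have "\<dots> \<le> 4 * (4 * (1 + a) ^ 3 * u ^ 3 + t ^ 3 * ((1 + a) ^ 3 * (4 * (1 + u ^ 3))))"
    proof (intro mult_left_mono add_mono v3)
      have "1 \<le> (1 + a) ^ 3" using assms by simp
      then have "1 \<le> 4 * (1 + a) ^ 3" by linarith
      then have "1 * u ^ 3 \<le> (4 * (1 + a) ^ 3) * u ^ 3"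
        using assms by (intro mult_right_mono) simp_all
      then show "u ^ 3 \<le> 4 * (1 + a) ^ 3 * u ^ 3" by simp
    qed (use assms in auto)
    also have "\<dots> = 16 * (1 + a) ^ 3 * (u ^ 3 + t ^ 3 * (1 + u ^ 3))"
      by (simp add: algebra_simps)
    finally show ?thesis .
  qed
  \<comment> \<open>One factor \<open>1 + u\<close> comes from \<open>1 + w\<close>, the other from
    \<open>v\<close>. Removing the linear term of their product leaves only the powers 0, 2, 3 and 5
    of \<open>u\<close> in the final bound, so the first absolute moment, whose rate is not among
    the hypotheses, never appears.\<close>
  have uu: "(1 + u) * (1 + u) \<le> 2 * (1 + u\<^sup>2)"
    using sum_squares_bound[of 1 u] by (simp add: power2_eq_square algebra_simps)
  \<comment> \<open>Stated for atoms \<open>b\<close> = 1 + a, \<open>p\<close> = 1 + u and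
    \<open>q\<close>, so that simplification regroups the factors without multiplying out these
    sums.\<close>
  have collect: "(2 * b * p) * (16 * b ^ 3 * q) * (t * (b * p)) = (p * p) * (32 * b ^ 5 * (t * q))" for b p q :: real
    by (simp add: eval_nat_numeral)
  have factor: "(2 * p) * (32 * b * (t * q)) = 64 * b * (t * (p * q))" for b p q :: real
    by simp
  have "(1 + w) * w ^ 3 * (t * v)
      \<le> (2 * (1 + a) * (1 + u)) * (16 * (1 + a) ^ 3 * (u ^ 3 + t ^ 3 * (1 + u ^ 3))) * (t * ((1 + a) * (1 + u)))"
    by (intro mult_mono w1 w3 v mult_nonneg_nonneg add_nonneg_nonneg)
      (use assms tv in auto)
  also have "\<dots> = ((1 + u) * (1 + u)) * (32 * (1 + a) ^ 5 * (t * (u ^ 3 + t ^ 3 * (1 + u ^ 3))))"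
    by (rule collect)
  also have "\<dots> \<le> (2 * (1 + u\<^sup>2)) * (32 * (1 + a) ^ 5 * (t * (u ^ 3 + t ^ 3 * (1 + u ^ 3))))"
    by (intro mult_right_mono uu) (use assms in auto)
  also have "\<dots> = 64 * (1 + a) ^ 5 * (t * ((1 + u\<^sup>2) * (u ^ 3 + t ^ 3 * (1 + u ^ 3))))"
    by (rule factor)
  finally show ?thesis .
qed

section \<open>Linear growth of the fourth derivative on the adjusted segments\<close>

text \<open>The sign \<open>e\<close> selects a side of \<open>\<theta>\<close>. If the estimates on that side are bounded by a point of \<open>D\<close>,
  the adjusted ones eventually stay in a compact part of \<open>D\<close>; otherwise every point of \<open>D\<close> on that
  side lies on a segment where \<open>M\<close> bounds \<open>f'\<close>.\<close>

lemma one_sided_growth: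
  fixes f f' :: "real \<Rightarrow> real" and \<Omega> :: "nat \<Rightarrow> 'w set" and T :: "nat \<Rightarrow> 'w \<Rightarrow> real"
  assumes D: "open D" "is_interval D" "\<theta> \<in> D"
    and der: "\<And>x. x \<in> D \<Longrightarrow> (f has_real_derivative f' x) (at x)"
    and M: "\<And>n \<omega> x. n \<ge> 1 \<Longrightarrow> \<omega> \<in> \<Omega> n \<Longrightarrow> x \<in> closed_segment \<theta> (T n \<omega>) \<Longrightarrow> \<bar>f' x\<bar> \<le> M"
    and inD: "\<And>l. \<forall>\<^sub>F n in sequentially. \<forall>\<omega>\<in>\<Omega> n. T n \<omega> * (1 + l / real n) \<in> D"
    and e: "e = 1 \<or> e = -1"
  shows "\<exists>A. \<forall>l. \<forall>\<^sub>F n in sequentially. \<forall>\<omega>\<in>\<Omega> n. \<forall>z\<in>closed_segment \<theta> (T n \<omega> * (1 + l / real n)).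
    e * \<theta> \<le> e * z \<longrightarrow> \<bar>f z\<bar> \<le> A * (1 + \<bar>z - \<theta>\<bar>)"
proof -
  have seg: "closed_segment x y \<subseteq> D" if "x \<in> D" "y \<in> D" for x y
    using that D(2) by (simp add: closed_segment_subset is_interval_convex_1)
  show ?thesis
  proof (cases "\<exists>b\<in>D. e * \<theta> \<le> e * b \<and> (\<forall>n\<ge>1. \<forall>\<omega>\<in>\<Omega> n. e * T n \<omega> \<le> e * b)")
    case True
    then obtain b where b: "b \<in> D" "e * \<theta> \<le> e * b" "\<And>n \<omega>. n \<ge> 1 \<Longrightarrow> \<omega> \<in> \<Omega> n \<Longrightarrow> e * T n \<omega> \<le> e * b"
      by blast
    \<comment> \<open>Openness of \<open>D\<close> gives room beyond \<open>b\<close>. The adjusted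
      estimates may pass \<open>b\<close>, but only up to \<open>b * (1 + l / real n)\<close>, which
      eventually stays on the near side of \<open>b' = b + e * \<delta>\<close>.\<close>
    obtain \<delta> where \<delta>: "\<delta> > 0" "cball b \<delta> \<subseteq> D"
      using D(1) b(1) open_contains_cball by blast
    define b' where "b' = b + e * \<delta>"
    have b': "b' \<in> D"
      using \<delta> e by (auto simp: b'_def dist_real_def subset_iff)
    have "compact (f ` closed_segment \<theta> b')"
    proof (rule compact_continuous_image)
      show "continuous_on (closed_segment \<theta> b') f"
        using seg[OF D(3) b'] by (intro continuous_at_imp_continuous_on ballI DERIV_isCont[OF der]) auto
    qed simp
    then have "\<exists>B. \<forall>z\<in>closed_segment \<theta> b'. \<bar>f z\<bar> \<le> B"
      by (auto dest!: compact_imp_bounded simp: bounded_iff)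
    then obtain B where B: "\<And>z. z \<in> closed_segment \<theta> b' \<Longrightarrow> \<bar>f z\<bar> \<le> B"
      by blast
    have "\<forall>\<^sub>F n in sequentially. \<forall>\<omega>\<in>\<Omega> n. \<forall>z\<in>closed_segment \<theta> (T n \<omega> * (1 + l / real n)).
      e * \<theta> \<le> e * z \<longrightarrow> \<bar>f z\<bar> \<le> B * (1 + \<bar>z - \<theta>\<bar>)" for l
    proof -
      have lim: "(\<lambda>n. 1 + l / real n) \<longlonglongrightarrow> 1 + 0"
        by (intro tendsto_intros lim_const_over_n)
      then have "(\<lambda>n. e * b * (1 + l / real n)) \<longlonglongrightarrow> e * b * (1 + 0)"
        by (intro tendsto_intros)
      then have ev: "\<forall>\<^sub>F n in sequentially. e * b * (1 + l / real n) < e * b + \<delta>"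
        by (rule order_tendstoD) (use \<delta> in simp)
      have "\<forall>\<^sub>F n in sequentially. 0 < 1 + l / real n"
        using lim by (rule order_tendstoD) simp
      then show ?thesis
        using ev eventually_ge_at_top[of 1]
      proof eventually_elim
        case (elim n)
        show ?case
        proof (intro ballI impI)
          fix \<omega> z
          assume \<omega>: "\<omega> \<in> \<Omega> n" and z: "z \<in> closed_segment \<theta> (T n \<omega> * (1 + l / real n))" and ez: "e * \<theta> \<le> e * z"
          have "e * T n \<omega> * (1 + l / real n) \<le> e * b * (1 + l / real n)"
            using b(3)[OF elim(3) \<omega>] elim(1) by (intro mult_right_mono) auto
          with elim(2) have "e * (T n \<omega> * (1 + l / real n)) \<le> e * b + \<delta>"
            by (simp add: mult.assoc)
          moreover have "e * b' = e * b + \<delta>"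
            using e by (auto simp: b'_def algebra_simps)
          ultimately have "z \<in> closed_segment \<theta> b'"
            using e z ez b(2) \<delta>(1) by (auto simp: closed_segment_eq_real_ivl split: if_splits)
          then have fz: "\<bar>f z\<bar> \<le> B" by (rule B)
          then have "0 \<le> B" by linarith
          then have "0 \<le> B * \<bar>z - \<theta>\<bar>" by simp
          with fz show "\<bar>f z\<bar> \<le> B * (1 + \<bar>z - \<theta>\<bar>)" unfolding distrib_left by linarith
        qed
      qed
    qed
    then show ?thesis by blast
  next
    case False
    have "\<forall>\<^sub>F n in sequentially. \<forall>\<omega>\<in>\<Omega> n. \<forall>z\<in>closed_segment \<theta> (T n \<omega> * (1 + l / real n)).
      e * \<theta> \<le> e * z \<longrightarrow> \<bar>f z\<bar> \<le> (\<bar>f \<theta>\<bar> + \<bar>M\<bar>) * (1 + \<bar>z - \<theta>\<bar>)" for l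
      using inD[of l]
    proof eventually_elim
      case (elim n)
      show ?case
      proof (intro ballI impI)
        fix \<omega> z
        assume \<omega>: "\<omega> \<in> \<Omega> n" and z: "z \<in> closed_segment \<theta> (T n \<omega> * (1 + l / real n))" and ez: "e * \<theta> \<le> e * z"
        have zD: "z \<in> D"
          using seg[OF D(3)] elim \<omega> z by blast
        \<comment> \<open>The failed case assumption, applied to \<open>z\<close> itself, yields an
          estimate beyond \<open>z\<close>. Its sample size \<open>m\<close> need not be
          \<open>n\<close>; this is harmless because \<open>M\<close> is uniform in the sample
          size.\<close>
        then obtain m \<omega>' where m: "m \<ge> 1" "\<omega>' \<in> \<Omega> m" "e * z < e * T m \<omega>'"
          using False ez by (auto simp: not_le)
        have sub: "closed_segment \<theta> z \<subseteq> closed_segment \<theta> (T m \<omega>')"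
          using e m(3) ez by (auto simp: closed_segment_eq_real_ivl split: if_splits)
        have "norm (f z - f \<theta>) \<le> M * norm (z - \<theta>)"
        proof (rule field_differentiable_bound[where S = "closed_segment \<theta> z" and f' = f'])
          fix x assume x: "x \<in> closed_segment \<theta> z"
          then show "(f has_field_derivative f' x) (at x within closed_segment \<theta> z)"
            using der seg[OF D(3) zD] has_field_derivative_at_within by blast
          show "norm (f' x) \<le> M"
            using M[OF m(1,2)] sub x by auto
        qed auto
        moreover have "M * \<bar>z - \<theta>\<bar> \<le> \<bar>M\<bar> * \<bar>z - \<theta>\<bar>"
          by (intro mult_right_mono) auto
        moreover have "0 \<le> \<bar>f \<theta>\<bar> * \<bar>z - \<theta>\<bar>" by simp
        ultimately show "\<bar>f z\<bar> \<le> (\<bar>f \<theta>\<bar> + \<bar>M\<bar>) * (1 + \<bar>z - \<theta>\<bar>)"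
          unfolding distrib_left distrib_right real_norm_def by linarith
      qed
    qed
    then show ?thesis by blast
  qed
qed

text \<open>The two signs together cover every \<open>z\<close>. The constant is chosen before
  \<open>l\<close>, so one \<open>A\<close> serves both the adjusted estimates and, at
  \<open>l = 0\<close>, the unadjusted ones.\<close>

lemma segment_growth:
  fixes f f' :: "real \<Rightarrow> real" and \<Omega> :: "nat \<Rightarrow> 'w set" and T :: "nat \<Rightarrow> 'w \<Rightarrow> real"
  assumes "open D" "is_interval D" "\<theta> \<in> D"
    and "\<And>x. x \<in> D \<Longrightarrow> (f has_real_derivative f' x) (at x)"
    and "\<And>n \<omega> x. n \<ge> 1 \<Longrightarrow> \<omega> \<in> \<Omega> n \<Longrightarrow> x \<in> closed_segment \<theta> (T n \<omega>) \<Longrightarrow> \<bar>f' x\<bar> \<le> M"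
    and "\<And>l. \<forall>\<^sub>F n in sequentially. \<forall>\<omega>\<in>\<Omega> n. T n \<omega> * (1 + l / real n) \<in> D"
  obtains A where "A \<ge> 0"
    and "\<And>l. \<forall>\<^sub>F n in sequentially. \<forall>\<omega>\<in>\<Omega> n. \<forall>z\<in>closed_segment \<theta> (T n \<omega> * (1 + l / real n)).
      \<bar>f z\<bar> \<le> A * (1 + \<bar>z - \<theta>\<bar>)"
proof -
  have growth: "\<exists>A. \<forall>l. \<forall>\<^sub>F n in sequentially. \<forall>\<omega>\<in>\<Omega> n. \<forall>z\<in>closed_segment \<theta> (T n \<omega> * (1 + l / real n)).
      e * \<theta> \<le> e * z \<longrightarrow> \<bar>f z\<bar> \<le> A * (1 + \<bar>z - \<theta>\<bar>)" if "e = 1 \<or> e = - 1" for e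
    by (rule one_sided_growth[of D \<theta> f f' \<Omega> T M]) (fact assms that)+
  obtain A1 where A1: "\<And>l. \<forall>\<^sub>F n in sequentially. \<forall>\<omega>\<in>\<Omega> n. \<forall>z\<in>closed_segment \<theta> (T n \<omega> * (1 + l / real n)).
      1 * \<theta> \<le> 1 * z \<longrightarrow> \<bar>f z\<bar> \<le> A1 * (1 + \<bar>z - \<theta>\<bar>)"
    using growth[where e = 1] by blast
  obtain A2 where A2: "\<And>l. \<forall>\<^sub>F n in sequentially. \<forall>\<omega>\<in>\<Omega> n. \<forall>z\<in>closed_segment \<theta> (T n \<omega> * (1 + l / real n)).
      - 1 * \<theta> \<le> - 1 * z \<longrightarrow> \<bar>f z\<bar> \<le> A2 * (1 + \<bar>z - \<theta>\<bar>)"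
    using growth[where e = "- 1"] by blast
  have le: "A1 * (1 + \<bar>z - \<theta>\<bar>) \<le> (\<bar>A1\<bar> + \<bar>A2\<bar>) * (1 + \<bar>z - \<theta>\<bar>)"
    "A2 * (1 + \<bar>z - \<theta>\<bar>) \<le> (\<bar>A1\<bar> + \<bar>A2\<bar>) * (1 + \<bar>z - \<theta>\<bar>)" for z
    by (auto intro!: mult_right_mono)
  show thesis
  proof (rule that[of "\<bar>A1\<bar> + \<bar>A2\<bar>"])
    show "\<forall>\<^sub>F n in sequentially. \<forall>\<omega>\<in>\<Omega> n. \<forall>z\<in>closed_segment \<theta> (T n \<omega> * (1 + l / real n)).
      \<bar>f z\<bar> \<le> (\<bar>A1\<bar> + \<bar>A2\<bar>) * (1 + \<bar>z - \<theta>\<bar>)" for l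
      using A1[of l] A2[of l]
    proof eventually_elim
      case (elim n)
      show ?case
      proof (intro ballI)
        fix \<omega> z
        assume z: "\<omega> \<in> \<Omega> n" "z \<in> closed_segment \<theta> (T n \<omega> * (1 + l / real n))"
        have "\<bar>f z\<bar> \<le> A1 * (1 + \<bar>z - \<theta>\<bar>) \<or> \<bar>f z\<bar> \<le> A2 * (1 + \<bar>z - \<theta>\<bar>)"
          using elim z by (cases "\<theta> \<le> z") auto
        then show "\<bar>f z\<bar> \<le> (\<bar>A1\<bar> + \<bar>A2\<bar>) * (1 + \<bar>z - \<theta>\<bar>)"
          using le[of z] by linarith
      qed
    qed
  qed simp
qed

section \<open>Integrability and moments of the estimation error\<close>

lemma integrable_affine_power:
  fixes u :: "'w \<Rightarrow> real"
  assumes "\<And>j. j \<le> k \<Longrightarrow> integrable M (\<lambda>\<omega>. u \<omega> ^ j)"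
  shows "integrable M (\<lambda>\<omega>. (b * u \<omega> + c) ^ k)"
proof -
  have "(\<lambda>\<omega>. (b * u \<omega> + c) ^ k) = (\<lambda>\<omega>. \<Sum>j\<le>k. (of_nat (k choose j) * b ^ j * c ^ (k - j)) * u \<omega> ^ j)"
    by (simp add: binomial_ring power_mult_distrib mult_ac)
  then show ?thesis
    using assms by (auto intro!: Bochner_Integration.integrable_sum integrable_mult_right)
qed

text \<open>The Landau hypotheses are restated as limits at the scale needed later: after
  multiplication by \<open>n^2\<close>, one factor \<open>n\<close> is absorbed by the adjustment
  \<open>l / real n\<close> and the other stays with the moment.\<close>

lemma estimator_sequence_moments:
  assumes "estimator_sequence \<theta> \<sigma> P T"
  shows "(\<lambda>n. real n * (\<integral>\<omega>. (T n \<omega> - \<theta>) \<partial>P n)) \<longlonglongrightarrow> 0"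
    and "(\<lambda>n. \<integral>\<omega>. (T n \<omega> - \<theta>)\<^sup>2 \<partial>P n) \<longlonglongrightarrow> 0"
    and "k \<ge> 3 \<Longrightarrow> (\<lambda>n. real n * (\<integral>\<omega>. \<bar>T n \<omega> - \<theta>\<bar> ^ k \<partial>P n)) \<longlonglongrightarrow> 0"
    and "k \<ge> 3 \<Longrightarrow> (\<lambda>n. \<integral>\<omega>. \<bar>T n \<omega> - \<theta>\<bar> ^ k \<partial>P n) \<longlonglongrightarrow> 0"
proof -
  have div_n: "f \<longlonglongrightarrow> 0" if "(\<lambda>n. real n * f n) \<longlonglongrightarrow> c" for f c
  proof -
    have "(\<lambda>n. (real n * f n) * (1 / real n)) \<longlonglongrightarrow> c * 0"
      by (intro tendsto_mult that lim_const_over_n)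
    moreover have "\<forall>\<^sub>F n in sequentially. (real n * f n) * (1 / real n) = f n"
      using eventually_gt_at_top[of 0] by eventually_elim simp
    ultimately show ?thesis
      by (simp add: tendsto_cong)
  qed
  have "(\<lambda>n. \<bar>\<integral>\<omega>. (T n \<omega> - \<theta>) \<partial>P n\<bar>) \<in> o(\<lambda>n. 1 / real n)"
    using assms by (simp add: estimator_sequence_def)
  then have "(\<lambda>n. \<bar>real n * (\<integral>\<omega>. (T n \<omega> - \<theta>) \<partial>P n)\<bar>) \<longlonglongrightarrow> 0"
    by (drule_tac smalloD_tendsto) (simp add: abs_mult mult.commute)
  then show "(\<lambda>n. real n * (\<integral>\<omega>. (T n \<omega> - \<theta>) \<partial>P n)) \<longlonglongrightarrow> 0"
    by (rule tendsto_rabs_zero_cancel)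
  show "(\<lambda>n. \<integral>\<omega>. (T n \<omega> - \<theta>)\<^sup>2 \<partial>P n) \<longlonglongrightarrow> 0"
    using assms div_n by (auto simp: estimator_sequence_def)
  show *: "(\<lambda>n. real n * (\<integral>\<omega>. \<bar>T n \<omega> - \<theta>\<bar> ^ k \<partial>P n)) \<longlonglongrightarrow> 0" if "k \<ge> 3"
  proof -
    \<comment> \<open>The ratio of the two powers has exponent \<open>1 - real k / 2\<close>, which
      is negative exactly because \<open>k \<ge> 3\<close>.\<close>
    have "(\<lambda>n. real n powr (- real k / 2)) \<in> o(\<lambda>n. real n powr (- 1))"
    proof (rule smalloI_tendsto)
      have "(\<lambda>n. real n powr (1 - real k / 2)) \<longlonglongrightarrow> 0"
        using that by (intro tendsto_neg_powr filterlim_real_sequentially) auto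
      then show "(\<lambda>n. real n powr (- real k / 2) / real n powr (- 1)) \<longlonglongrightarrow> 0"
        by (simp only: powr_diff[symmetric]) simp
    qed (use eventually_gt_at_top[of 0] in eventually_elim, simp)
    then have "(\<lambda>n. \<integral>\<omega>. \<bar>T n \<omega> - \<theta>\<bar> ^ k \<partial>P n) \<in> o(\<lambda>n. real n powr (- 1))"
      using assms that by (auto simp: estimator_sequence_def intro: landau_o.big_small_trans)
    then show ?thesis
      by (drule_tac smalloD_tendsto) (simp add: powr_minus field_simps)
  qed
  show "(\<lambda>n. \<integral>\<omega>. \<bar>T n \<omega> - \<theta>\<bar> ^ k \<partial>P n) \<longlonglongrightarrow> 0" if "k \<ge> 3"
    by (rule div_n[OF *[OF that]])
qed

section \<open>Pointwise bounds for adjusted rewards\<close>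

text \<open>This supplies an integrable majorant: the increment estimate started at
  \<open>x = \<theta>\<close> bounds the reward by a polynomial of degree five in the
  distance.\<close>

lemma reward_growth:
  fixes g :: "nat \<Rightarrow> real \<Rightarrow> real"
  assumes der: "\<And>j z. j < 4 \<Longrightarrow> z \<in> closed_segment \<theta> y \<Longrightarrow> (g j has_real_derivative g (Suc j) z) (at z)"
    and crit: "g 1 \<theta> = 0"
    and growth: "\<And>z. z \<in> closed_segment \<theta> y \<Longrightarrow> \<bar>g 4 z\<bar> \<le> A * (1 + \<bar>z - \<theta>\<bar>)"
    and w: "\<bar>y - \<theta>\<bar> \<le> w"
  shows "\<bar>g 0 y\<bar> \<le> \<bar>g 0 \<theta>\<bar> + \<bar>g 2 \<theta> / 2\<bar> * w\<^sup>2 + \<bar>g 3 \<theta> / 6\<bar> * w ^ 3 + A * (w ^ 4 + w ^ 5)"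
proof -
  have A: "0 \<le> A"
    using growth[of \<theta>] by auto
  have w0: "0 \<le> w" using w by linarith
  have "\<bar>g 0 y - g 0 \<theta> - (g 2 \<theta> / 2 * ((y - \<theta>)\<^sup>2 - (\<theta> - \<theta>)\<^sup>2) + g 3 \<theta> / 6 * ((y - \<theta>) ^ 3 - (\<theta> - \<theta>) ^ 3))\<bar>
      \<le> A * (1 + w) * w ^ 3 * \<bar>y - \<theta>\<bar>"
    by (rule cubic_taylor_increment) (use der crit growth w w0 in auto)
  then have 1: "\<bar>g 0 y - g 0 \<theta> - (g 2 \<theta> / 2 * (y - \<theta>)\<^sup>2 + g 3 \<theta> / 6 * (y - \<theta>) ^ 3)\<bar>
      \<le> A * (1 + w) * w ^ 3 * \<bar>y - \<theta>\<bar>" by simp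
  have "A * (1 + w) * w ^ 3 * \<bar>y - \<theta>\<bar> \<le> A * (1 + w) * w ^ 3 * w"
    by (intro mult_left_mono w) (use A w0 in auto)
  also have "\<dots> = A * (w ^ 4 + w ^ 5)"
    by (simp add: algebra_simps eval_nat_numeral)
  finally have 2: "A * (1 + w) * w ^ 3 * \<bar>y - \<theta>\<bar> \<le> A * (w ^ 4 + w ^ 5)" .
  have 3: "\<bar>g 2 \<theta> / 2 * (y - \<theta>)\<^sup>2\<bar> \<le> \<bar>g 2 \<theta> / 2\<bar> * w\<^sup>2"
    unfolding abs_mult power_abs by (intro mult_left_mono power_mono w) auto
  have 4: "\<bar>g 3 \<theta> / 6 * (y - \<theta>) ^ 3\<bar> \<le> \<bar>g 3 \<theta> / 6\<bar> * w ^ 3"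
    unfolding abs_mult power_abs by (intro mult_left_mono power_mono w) auto
  show ?thesis
    using 1 2 3 4 by linarith
qed

text \<open>For \<open>y = x * (1 + s)\<close> the displacement is
  \<open>\<bar>s\<bar> * \<bar>x\<bar>\<close>, so
  \<open>w = u + \<bar>s\<bar> * \<bar>x\<bar>\<close> dominates both distances to
  \<open>\<theta>\<close> and \<open>remainder_polynomial_le\<close> separates the powers of
  \<open>u\<close> from those of \<open>s\<close>.\<close>

lemma reward_increment_le:
  fixes g :: "nat \<Rightarrow> real \<Rightarrow> real" and s x \<theta> :: real
  defines "y \<equiv> x * (1 + s)" and "u \<equiv> \<bar>x - \<theta>\<bar>"
  assumes der: "\<And>j z. j < 4 \<Longrightarrow> z \<in> closed_segment \<theta> x \<union> closed_segment \<theta> y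
      \<Longrightarrow> (g j has_real_derivative g (Suc j) z) (at z)"
    and crit: "g 1 \<theta> = 0"
    and growth: "\<And>z. z \<in> closed_segment \<theta> x \<union> closed_segment \<theta> y \<Longrightarrow> \<bar>g 4 z\<bar> \<le> A * (1 + \<bar>z - \<theta>\<bar>)"
    and s: "\<bar>s\<bar> \<le> 1"
  shows "\<bar>g 0 y - g 0 x - (g 2 \<theta> / 2 * ((y - \<theta>)\<^sup>2 - (x - \<theta>)\<^sup>2) + g 3 \<theta> / 6 * ((y - \<theta>) ^ 3 - (x - \<theta>) ^ 3))\<bar>
    \<le> A * (64 * (1 + \<bar>\<theta>\<bar>) ^ 5) * (\<bar>s\<bar> * ((1 + u\<^sup>2) * (u ^ 3 + \<bar>s\<bar> ^ 3 * (1 + u ^ 3))))"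
proof -
  define w where "w = u + \<bar>s\<bar> * \<bar>x\<bar>"
  have A: "0 \<le> A"
    using growth[of \<theta>] by auto
  have yx: "\<bar>y - x\<bar> = \<bar>s\<bar> * \<bar>x\<bar>"
    by (simp add: y_def algebra_simps abs_mult)
  have w: "\<bar>x - \<theta>\<bar> \<le> w" "\<bar>y - \<theta>\<bar> \<le> w"
    using yx by (auto simp: w_def u_def)
  have "\<bar>g 0 y - g 0 x - (g 2 \<theta> / 2 * ((y - \<theta>)\<^sup>2 - (x - \<theta>)\<^sup>2) + g 3 \<theta> / 6 * ((y - \<theta>) ^ 3 - (x - \<theta>) ^ 3))\<bar>
      \<le> A * (1 + w) * w ^ 3 * \<bar>y - x\<bar>"
    by (rule cubic_taylor_increment) (use der crit growth w in auto)
  also have "\<dots> = A * ((1 + w) * w ^ 3 * (\<bar>s\<bar> * \<bar>x\<bar>))"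
    by (simp add: yx mult_ac)
  also have "\<dots> \<le> A * (64 * (1 + \<bar>\<theta>\<bar>) ^ 5 * (\<bar>s\<bar> * ((1 + u\<^sup>2) * (u ^ 3 + \<bar>s\<bar> ^ 3 * (1 + u ^ 3)))))"
    by (intro mult_left_mono remainder_polynomial_le A) (use s in \<open>auto simp: w_def u_def\<close>)
  finally show ?thesis by (simp add: mult_ac)
qed

text \<open>Substitute \<open>x * (1 + s) - \<theta> = (1 + s) * (x - \<theta>) + s *
  \<theta>\<close> and collect powers of the error; a factor \<open>s\<close> comes out of every
  coefficient.\<close>

lemma adjusted_polynomial_increment:
  fixes c d s x \<theta> :: real
  shows "c * ((x * (1 + s) - \<theta>)\<^sup>2 - (x - \<theta>)\<^sup>2) + d * ((x * (1 + s) - \<theta>) ^ 3 - (x - \<theta>) ^ 3)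
    = (c * (s * \<theta>)\<^sup>2 + d * (s * \<theta>) ^ 3)
      + s * (2 * c * (1 + s) * \<theta> + 3 * d * (1 + s) * s * \<theta>\<^sup>2) * (x - \<theta>)
      + s * (c * (2 + s) + 3 * d * (1 + s)\<^sup>2 * \<theta>) * (x - \<theta>)\<^sup>2
      + s * (d * (3 + 3 * s + s\<^sup>2)) * (x - \<theta>) ^ 3"
  by (simp add: algebra_simps eval_nat_numeral)

section \<open>Limits of the polynomial part and of the remainder\<close>

text \<open>Each moment has its own threshold in \<open>n\<close>; finitely many moments share
  one.\<close>

lemma estimator_sequence_integrable:
  assumes "estimator_sequence \<theta> \<sigma> P T"
  shows "\<forall>\<^sub>F n in sequentially. \<forall>k\<le>N. integrable (P n) (\<lambda>\<omega>. \<bar>T n \<omega> - \<theta>\<bar> ^ k)"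
proof -
  have "\<forall>\<^sub>F n in sequentially. \<forall>k\<in>{..N}. integrable (P n) (\<lambda>\<omega>. \<bar>T n \<omega> - \<theta>\<bar> ^ k)"
    using assms by (intro eventually_ball_finite) (auto simp: estimator_sequence_def)
  then show ?thesis by (simp add: Ball_def)
qed

text \<open>Since \<open>real n * s n = l\<close>, each moment keeps one factor \<open>n\<close>.
  Only the second moment survives, next to the deterministic square; the deterministic cube still
  carries a factor \<open>s n\<close> and vanishes.\<close>

lemma polynomial_increment_tendsto:
  fixes c d l \<theta> :: real and E1 E2 E3 :: "nat \<Rightarrow> real"
  assumes "(\<lambda>n. real n * E1 n) \<longlonglongrightarrow> 0" "(\<lambda>n. real n * E2 n) \<longlonglongrightarrow> v" "(\<lambda>n. real n * E3 n) \<longlonglongrightarrow> 0"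
    and s: "\<And>n. s n = l / real n"
  shows "(\<lambda>n. (real n)\<^sup>2 * ((c * (s n * \<theta>)\<^sup>2 + d * (s n * \<theta>) ^ 3)
      + s n * (2 * c * (1 + s n) * \<theta> + 3 * d * (1 + s n) * s n * \<theta>\<^sup>2) * E1 n
      + s n * (c * (2 + s n) + 3 * d * (1 + s n)\<^sup>2 * \<theta>) * E2 n
      + s n * (d * (3 + 3 * s n + (s n)\<^sup>2)) * E3 n))
    \<longlonglongrightarrow> c * (l * \<theta>)\<^sup>2 + l * (2 * c + 3 * d * \<theta>) * v" (is "?f \<longlonglongrightarrow> _")
proof -
  have s0: "s \<longlonglongrightarrow> 0"
    unfolding s by (rule lim_const_over_n)
  have "(\<lambda>n. (c * (l * \<theta>)\<^sup>2 + d * l\<^sup>2 * \<theta> ^ 3 * s n)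
      + l * (2 * c * (1 + s n) * \<theta> + 3 * d * (1 + s n) * s n * \<theta>\<^sup>2) * (real n * E1 n)
      + l * (c * (2 + s n) + 3 * d * (1 + s n)\<^sup>2 * \<theta>) * (real n * E2 n)
      + l * (d * (3 + 3 * s n + (s n)\<^sup>2)) * (real n * E3 n))
    \<longlonglongrightarrow> (c * (l * \<theta>)\<^sup>2 + d * l\<^sup>2 * \<theta> ^ 3 * 0)
      + l * (2 * c * (1 + 0) * \<theta> + 3 * d * (1 + 0) * 0 * \<theta>\<^sup>2) * 0
      + l * (c * (2 + 0) + 3 * d * (1 + 0)\<^sup>2 * \<theta>) * v
      + l * (d * (3 + 3 * 0 + 0\<^sup>2)) * 0" (is "?h \<longlonglongrightarrow> ?L")
    by (intro tendsto_intros assms s0)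
  moreover have "\<forall>\<^sub>F n in sequentially. ?h n = ?f n"
    using eventually_gt_at_top[of 0]
  proof eventually_elim
    case (elim n)
    then have l: "l = real n * s n" by (simp add: s)
    show ?case
      unfolding l by (simp add: algebra_simps eval_nat_numeral)
  qed
  ultimately have "?f \<longlonglongrightarrow> ?L"
    by (rule Lim_transform_eventually)
  then show ?thesis by (simp add: mult.commute)
qed

text \<open>The terms linear in \<open>s n\<close> become \<open>l\<close> times \<open>n\<close>
  times a moment of order 3 or 5. In the quartic terms, \<open>n^2\<close> cancels two factors
  \<open>s n\<close> and the other two tend to 0.\<close>

lemma remainder_tendsto:
  fixes m2 m3 m5 :: "nat \<Rightarrow> real"
  assumes "m2 \<longlonglongrightarrow> 0" "m3 \<longlonglongrightarrow> 0" "m5 \<longlonglongrightarrow> 0"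
    and "(\<lambda>n. real n * m3 n) \<longlonglongrightarrow> 0" "(\<lambda>n. real n * m5 n) \<longlonglongrightarrow> 0"
    and s: "\<And>n. s n = l / real n"
  shows "(\<lambda>n. (real n)\<^sup>2 * (K * (\<bar>s n\<bar> * (m3 n + m5 n + \<bar>s n\<bar> ^ 3 * (1 + m2 n + m3 n + m5 n))))) \<longlonglongrightarrow> 0"
    (is "?f \<longlonglongrightarrow> _")
proof -
  have s0: "s \<longlonglongrightarrow> 0"
    unfolding s by (rule lim_const_over_n)
  have "(\<lambda>n. K * (\<bar>l\<bar> * (real n * m3 n + real n * m5 n) + \<bar>l\<bar>\<^sup>2 * \<bar>s n\<bar>\<^sup>2 * (1 + m2 n + m3 n + m5 n)))
      \<longlonglongrightarrow> K * (\<bar>l\<bar> * (0 + 0) + \<bar>l\<bar>\<^sup>2 * \<bar>0\<bar>\<^sup>2 * (1 + 0 + 0 + 0))" (is "?h \<longlonglongrightarrow> ?L")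
    by (intro tendsto_intros assms s0)
  moreover have "\<forall>\<^sub>F n in sequentially. ?h n = ?f n"
    using eventually_gt_at_top[of 0]
  proof eventually_elim
    case (elim n)
    then have l: "\<bar>l\<bar> = real n * \<bar>s n\<bar>" by (simp add: s)
    show ?case
      unfolding l by (simp add: algebra_simps eval_nat_numeral)
  qed
  ultimately have "?f \<longlonglongrightarrow> ?L"
    by (rule Lim_transform_eventually)
  then show ?thesis by simp
qed

section \<open>Asymptotic improvement for an arbitrary coefficient\<close>

text \<open>Integrability comes first because the second claim merges the two expectations into one.
  It is shown for every \<open>l\<close>, so \<open>l = 0\<close> gives the unadjusted
  reward.\<close>

lemma
  fixes D :: "real set" and r :: "real \<Rightarrow> real" and P :: "nat \<Rightarrow> 'w measure"
  assumes D: "open D" "is_interval D" "\<theta> \<in> D"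
    and diff: "\<And>j x. j < 5 \<Longrightarrow> x \<in> D \<Longrightarrow> (deriv ^^ j) r field_differentiable (at x)"
    and crit: "deriv r \<theta> = 0"
    and est: "estimator_sequence \<theta> \<sigma> P T"
    and comp: "compatible \<theta> D r P T"
  shows integrable_adjusted_reward:
      "\<forall>\<^sub>F n in sequentially. integrable (P n) (\<lambda>\<omega>. r (T n \<omega> * (1 + l / real n)))"
    and scaled_improvement_tendsto:
      "scaled_improvement r P T l \<longlonglongrightarrow>
        (deriv ^^ 2) r \<theta> / 2 * (l * \<theta>)\<^sup>2 + l * (2 * ((deriv ^^ 2) r \<theta> / 2) + 3 * ((deriv ^^ 3) r \<theta> / 6) * \<theta>) * \<sigma>\<^sup>2"
proof -
  define g where "g j = (deriv ^^ j) r" for j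
  have g0: "g 0 = r" and g1: "g 1 \<theta> = 0"
    using crit by (auto simp: g_def)
  have der: "(g j has_real_derivative g (Suc j) x) (at x)" if "j < 5" "x \<in> D" for j x
    using diff[OF that] by (simp add: g_def field_differentiable_derivI)
  have seg: "closed_segment \<theta> y \<subseteq> D" if "y \<in> D" for y
    using that D by (simp add: closed_segment_subset is_interval_convex_1)
  have inD: "\<forall>\<^sub>F n in sequentially. \<forall>\<omega>\<in>space (P n). T n \<omega> * (1 + l / real n) \<in> D" for l
    using comp by (auto simp: compatible_def)
  obtain M where M: "\<And>n \<omega> x. n \<ge> 1 \<Longrightarrow> \<omega> \<in> space (P n) \<Longrightarrow> x \<in> closed_segment \<theta> (T n \<omega>) \<Longrightarrow> \<bar>g 5 x\<bar> \<le> M"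
    using comp unfolding compatible_def g_def by blast
  obtain A where A: "A \<ge> 0"
    and growth: "\<And>l. \<forall>\<^sub>F n in sequentially. \<forall>\<omega>\<in>space (P n). \<forall>z\<in>closed_segment \<theta> (T n \<omega> * (1 + l / real n)).
      \<bar>g 4 z\<bar> \<le> A * (1 + \<bar>z - \<theta>\<bar>)"
    by (rule segment_growth[of D \<theta> "g 4" "g 5" "\<lambda>n. space (P n)" T M])
      (use D der[of 4] M inD in auto)
  have prob: "prob_space (P n)" and meas: "T n \<in> borel_measurable (P n)" if "n \<ge> 1" for n
    using est that by (auto simp: estimator_sequence_def)
  define H where "H w = \<bar>g 0 \<theta>\<bar> + \<bar>g 2 \<theta> / 2\<bar> * w\<^sup>2 + \<bar>g 3 \<theta> / 6\<bar> * w ^ 3 + A * (w ^ 4 + w ^ 5)" for w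
  show int: "\<forall>\<^sub>F n in sequentially. integrable (P n) (\<lambda>\<omega>. r (T n \<omega> * (1 + l / real n)))" for l
    using inD[of l] growth[of l] estimator_sequence_integrable[OF est, of 5] eventually_ge_at_top[of 1]
  proof eventually_elim
    case (elim n)
    interpret prob_space "P n" by (rule prob) (rule elim)
    note [measurable] = meas[OF elim(4)]
    define t where "t = \<bar>l / real n\<bar>"
    \<comment> \<open>From \<open>y - \<theta> = (1 + l / real n) * (T n \<omega> - \<theta>) + l /
      real n * \<theta>\<close>, this affine function of the absolute error dominates the distance
      of the adjusted estimate from \<open>\<theta>\<close>; its powers up to 5 are
      integrable.\<close>
    define w where "w \<omega> = (1 + t) * \<bar>T n \<omega> - \<theta>\<bar> + t * \<bar>\<theta>\<bar>" for \<omega>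
    \<comment> \<open>Continuity of \<open>r\<close> is known on \<open>D\<close> only, so
      measurability passes through the Borel space restricted to \<open>D\<close>, where the
      adjusted estimates eventually take their values.\<close>
    have "continuous_on D r"
      using der[of 0] by (auto simp: g0 intro!: continuous_at_imp_continuous_on DERIV_isCont)
    then have "r \<in> borel_measurable (restrict_space borel D)"
      by (rule borel_measurable_continuous_on_restrict)
    moreover have "(\<lambda>\<omega>. T n \<omega> * (1 + l / real n)) \<in> measurable (P n) (restrict_space borel D)"
      using elim(1) by (intro measurable_restrict_space2) auto
    ultimately have mr: "(\<lambda>\<omega>. r (T n \<omega> * (1 + l / real n))) \<in> borel_measurable (P n)"
      by (rule measurable_compose_rev)
    have "integrable (P n) (\<lambda>\<omega>. w \<omega> ^ k)" if "k \<le> 5" for k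
      unfolding w_def using elim(3) that by (intro integrable_affine_power) auto
    then have "integrable (P n) (\<lambda>\<omega>. H (w \<omega>))"
      unfolding H_def by simp
    then show ?case
    proof (rule Bochner_Integration.integrable_bound[OF _ mr], intro AE_I2)
      fix \<omega> assume \<omega>: "\<omega> \<in> space (P n)"
      let ?y = "T n \<omega> * (1 + l / real n)"
      have "\<bar>?y - \<theta>\<bar> \<le> w \<omega>"
      proof -
        have "?y - \<theta> = (1 + l / real n) * (T n \<omega> - \<theta>) + l / real n * \<theta>"
          by (simp add: algebra_simps)
        then have "\<bar>?y - \<theta>\<bar> \<le> \<bar>1 + l / real n\<bar> * \<bar>T n \<omega> - \<theta>\<bar> + t * \<bar>\<theta>\<bar>"
          using abs_triangle_ineq[of "(1 + l / real n) * (T n \<omega> - \<theta>)" "l / real n * \<theta>"]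
          by (simp add: abs_mult t_def)
        also have "\<dots> \<le> w \<omega>"
          unfolding w_def by (intro add_mono mult_right_mono)
            (use abs_triangle_ineq[of 1 "l / real n"] in \<open>auto simp: t_def\<close>)
        finally show ?thesis .
      qed
      then have "\<bar>g 0 ?y\<bar> \<le> H (w \<omega>)"
        unfolding H_def using elim(1,2) \<omega> seg[of ?y] g1
        by (intro reward_growth der) auto
      then show "norm (r ?y) \<le> norm (H (w \<omega>))"
        by (simp add: g0)
    qed
  qed
  define s where "s n = l / real n" for n
  define X where "X n \<omega> = T n \<omega> - \<theta>" for n \<omega>
  define c where "c = g 2 \<theta> / 2"
  define d where "d = g 3 \<theta> / 6"
  define K where "K = A * (64 * (1 + \<bar>\<theta>\<bar>) ^ 5)"
  define m where "m k n = (\<integral>\<omega>. \<bar>X n \<omega>\<bar> ^ k \<partial>P n)" for k n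
  define E where "E k n = (\<integral>\<omega>. X n \<omega> ^ k \<partial>P n)" for k n
  \<comment> \<open>\<open>q n\<close> will be the expected increment of the cubic polynomial and
    \<open>B n\<close> the expected error bound. The former involves the signed moments
    \<open>E\<close>, the latter the absolute moments \<open>m\<close>.\<close>
  define q where "q n = (c * (s n * \<theta>)\<^sup>2 + d * (s n * \<theta>) ^ 3)
      + s n * (2 * c * (1 + s n) * \<theta> + 3 * d * (1 + s n) * s n * \<theta>\<^sup>2) * E 1 n
      + s n * (c * (2 + s n) + 3 * d * (1 + s n)\<^sup>2 * \<theta>) * E 2 n
      + s n * (d * (3 + 3 * s n + (s n)\<^sup>2)) * E 3 n" for n
  define B where "B n = K * (\<bar>s n\<bar> * (m 3 n + m 5 n + \<bar>s n\<bar> ^ 3 * (1 + m 2 n + m 3 n + m 5 n)))" for n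
  note moments = estimator_sequence_moments[OF est, folded X_def]
  have "(\<lambda>n. real n * E 3 n) \<longlonglongrightarrow> 0"
  proof (rule tendsto_rabs_zero_cancel, rule tendsto_sandwich[OF _ _ tendsto_const])
    show "(\<lambda>n. real n * m 3 n) \<longlonglongrightarrow> 0"
      unfolding m_def by (rule moments) simp
    have "\<bar>E 3 n\<bar> \<le> m 3 n" for n
      unfolding E_def m_def power_abs[symmetric] by (rule integral_abs_bound)
    then show "\<forall>\<^sub>F n in sequentially. \<bar>real n * E 3 n\<bar> \<le> real n * m 3 n"
      by (simp add: abs_mult mult_left_mono)
  qed simp
  then have qlim: "(\<lambda>n. (real n)\<^sup>2 * q n) \<longlonglongrightarrow> c * (l * \<theta>)\<^sup>2 + l * (2 * c + 3 * d * \<theta>) * \<sigma>\<^sup>2"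
    unfolding q_def using moments(1) est
    by (intro polynomial_increment_tendsto s_def) (auto simp: E_def X_def estimator_sequence_def)
  have Blim: "(\<lambda>n. (real n)\<^sup>2 * B n) \<longlonglongrightarrow> 0"
    unfolding B_def using moments by (intro remainder_tendsto[where l = l] s_def) (auto simp: m_def)
  have "\<forall>\<^sub>F n in sequentially. norm (scaled_improvement r P T l n - (real n)\<^sup>2 * q n) \<le> (real n)\<^sup>2 * B n"
  proof -
    have "(\<lambda>n. \<bar>s n\<bar>) \<longlonglongrightarrow> \<bar>0\<bar>"
      unfolding s_def by (intro tendsto_rabs lim_const_over_n)
    then have "\<forall>\<^sub>F n in sequentially. \<bar>s n\<bar> < 1"
      by (rule order_tendstoD) simp
    \<comment> \<open>The instances at 0 provide domain membership, growth and integrability for the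
      unadjusted estimates.\<close>
    then show ?thesis
      using inD[of l] inD[of 0] growth[of l] growth[of 0] int[of l] int[of 0]
        estimator_sequence_integrable[OF est, of 5] eventually_ge_at_top[of 1]
    proof eventually_elim
      case (elim n)
      interpret prob_space "P n" by (rule prob) (rule elim)
      note [measurable] = meas[OF elim(9)]
      let ?y = "\<lambda>\<omega>. T n \<omega> * (1 + s n)"
      let ?p = "\<lambda>\<omega>. c * ((?y \<omega> - \<theta>)\<^sup>2 - (T n \<omega> - \<theta>)\<^sup>2) + d * ((?y \<omega> - \<theta>) ^ 3 - (T n \<omega> - \<theta>) ^ 3)"
      let ?b = "\<lambda>\<omega>. K * (\<bar>s n\<bar> * ((1 + \<bar>T n \<omega> - \<theta>\<bar>\<^sup>2) * (\<bar>T n \<omega> - \<theta>\<bar> ^ 3 + \<bar>s n\<bar> ^ 3 * (1 + \<bar>T n \<omega> - \<theta>\<bar> ^ 3))))"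
      have intm: "integrable (P n) (\<lambda>\<omega>. \<bar>X n \<omega>\<bar> ^ k)" if "k \<le> 5" for k
        using elim(8) that by (simp add: X_def)
      have intX: "integrable (P n) (\<lambda>\<omega>. X n \<omega> ^ k)" if "k \<le> 5" for k
        by (rule Bochner_Integration.integrable_bound[OF intm[OF that]]) (auto simp: X_def power_abs)
      have p_eq: "?p = (\<lambda>\<omega>. (c * (s n * \<theta>)\<^sup>2 + d * (s n * \<theta>) ^ 3)
          + s n * (2 * c * (1 + s n) * \<theta> + 3 * d * (1 + s n) * s n * \<theta>\<^sup>2) * X n \<omega> ^ 1
          + s n * (c * (2 + s n) + 3 * d * (1 + s n)\<^sup>2 * \<theta>) * X n \<omega> ^ 2
          + s n * (d * (3 + 3 * s n + (s n)\<^sup>2)) * X n \<omega> ^ 3)"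
        unfolding X_def power_one_right by (rule ext, rule adjusted_polynomial_increment)
      have intp: "integrable (P n) ?p"
        unfolding p_eq by (intro Bochner_Integration.integrable_add integrable_mult_right intX integrable_const) auto
      have Ep: "integral\<^sup>L (P n) ?p = q n"
        unfolding p_eq q_def E_def using intX[of 1] intX[of 2] intX[of 3] by (simp add: prob_space)
      \<comment> \<open>Multiplying \<open>1 + u^2\<close> by \<open>u^3\<close> and by
        \<open>1 + u^3\<close> produces just the powers 0, 2, 3 and 5, matching the moments in
        \<open>B n\<close>.\<close>
      have b_eq: "?b = (\<lambda>\<omega>. K * (\<bar>s n\<bar> * (\<bar>X n \<omega>\<bar> ^ 3 + \<bar>X n \<omega>\<bar> ^ 5
          + \<bar>s n\<bar> ^ 3 * (1 + \<bar>X n \<omega>\<bar> ^ 2 + \<bar>X n \<omega>\<bar> ^ 3 + \<bar>X n \<omega>\<bar> ^ 5))))"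
        unfolding X_def[symmetric]
        by (rule ext) (simp only: distrib_left distrib_right mult_1 mult_1_right power_add[symmetric], simp add: eval_nat_numeral algebra_simps)
      have intb: "integrable (P n) ?b"
        unfolding b_eq by (intro Bochner_Integration.integrable_add integrable_mult_right intm integrable_const) auto
      have Eb: "integral\<^sup>L (P n) ?b = B n"
        unfolding b_eq B_def m_def using intm[of 2] intm[of 3] intm[of 5] by (simp add: prob_space)
      have intr: "integrable (P n) (\<lambda>\<omega>. r (?y \<omega>))" "integrable (P n) (\<lambda>\<omega>. r (T n \<omega>))"
        using elim(6,7) by (simp_all add: s_def)
      have "\<bar>\<integral>\<omega>. r (?y \<omega>) - r (T n \<omega>) - ?p \<omega> \<partial>P n\<bar> \<le> integral\<^sup>L (P n) ?b"
      proof (rule order_trans[OF integral_abs_bound], rule integral_mono)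
        show "integrable (P n) (\<lambda>\<omega>. \<bar>r (?y \<omega>) - r (T n \<omega>) - ?p \<omega>\<bar>)"
          by (intro integrable_abs Bochner_Integration.integrable_diff intr intp)
        fix \<omega> assume \<omega>: "\<omega> \<in> space (P n)"
        then have inside: "T n \<omega> \<in> D" "?y \<omega> \<in> D"
          using elim(2,3) by (auto simp: s_def)
        show "\<bar>r (?y \<omega>) - r (T n \<omega>) - ?p \<omega>\<bar> \<le> ?b \<omega>"
          unfolding c_def d_def K_def g0[symmetric]
        proof (rule reward_increment_le[where g = g])
          show "(g j has_real_derivative g (Suc j) z) (at z)"
            if "j < 4" "z \<in> closed_segment \<theta> (T n \<omega>) \<union> closed_segment \<theta> (?y \<omega>)" for j z
            using that seg[OF inside(1)] seg[OF inside(2)] by (intro der) auto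
          show "\<bar>g 4 z\<bar> \<le> A * (1 + \<bar>z - \<theta>\<bar>)"
            if "z \<in> closed_segment \<theta> (T n \<omega>) \<union> closed_segment \<theta> (?y \<omega>)" for z
            using that elim(4,5) \<omega> by (auto simp: s_def)
          show "g 1 \<theta> = 0" by (rule g1)
          show "\<bar>s n\<bar> \<le> 1" using elim(1) by simp
        qed
      qed (rule intb)
      moreover have "(\<integral>\<omega>. r (?y \<omega>) - r (T n \<omega>) - ?p \<omega> \<partial>P n)
          = (\<integral>\<omega>. r (?y \<omega>) \<partial>P n) - (\<integral>\<omega>. r (T n \<omega>) \<partial>P n) - integral\<^sup>L (P n) ?p"
        using intr intp by (simp only: Bochner_Integration.integral_diff Bochner_Integration.integrable_diff)
      ultimately have "\<bar>(\<integral>\<omega>. r (?y \<omega>) \<partial>P n) - (\<integral>\<omega>. r (T n \<omega>) \<partial>P n) - q n\<bar> \<le> B n"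
        using Ep Eb by simp
      then have "(real n)\<^sup>2 * \<bar>(\<integral>\<omega>. r (?y \<omega>) \<partial>P n) - (\<integral>\<omega>. r (T n \<omega>) \<partial>P n) - q n\<bar> \<le> (real n)\<^sup>2 * B n"
        by (intro mult_left_mono) auto
      moreover have "scaled_improvement r P T l n - (real n)\<^sup>2 * q n
          = (real n)\<^sup>2 * ((\<integral>\<omega>. r (?y \<omega>) \<partial>P n) - (\<integral>\<omega>. r (T n \<omega>) \<partial>P n) - q n)"
        by (simp add: scaled_improvement_def s_def right_diff_distrib)
      ultimately show ?case
        by (simp add: abs_mult)
    qed
  qed
  then have "(\<lambda>n. scaled_improvement r P T l n - (real n)\<^sup>2 * q n) \<longlonglongrightarrow> 0"
    by (rule Lim_null_comparison) (rule Blim)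
  from tendsto_add[OF this qlim] show "scaled_improvement r P T l \<longlonglongrightarrow>
      (deriv ^^ 2) r \<theta> / 2 * (l * \<theta>)\<^sup>2 + l * (2 * ((deriv ^^ 2) r \<theta> / 2) + 3 * ((deriv ^^ 3) r \<theta> / 6) * \<theta>) * \<sigma>\<^sup>2"
    by (simp add: c_def d_def g_def)
qed

section \<open>The optimal coefficient\<close>

text \<open>With the third derivative replaced by \<open>C / \<theta>\<close> times the second, the
  scaling \<open>k * \<sigma>^2 / \<theta>^2\<close> makes both terms of the limit proportional to
  \<open>\<sigma> ^ 4 / \<theta>^2\<close>. What remains is \<open>k^2 + (C + 2) * k\<close>, shown
  here with the square completed.\<close>

lemma valid_scaled_improvement_tendsto:
  assumes "regular_reward Th D R C" and "valid Th D R \<theta> \<sigma> P T"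
  shows "scaled_improvement (R \<theta>) P T (k * \<sigma>\<^sup>2 / \<theta>\<^sup>2) \<longlonglongrightarrow>
    (deriv ^^ 2) (R \<theta>) \<theta> * \<sigma> ^ 4 / (2 * \<theta>\<^sup>2) * ((k + (C + 2) / 2)\<^sup>2 - ((C + 2) / 2)\<^sup>2)"
proof -
  have \<theta>: "\<theta> \<noteq> 0" "(deriv ^^ 2) (R \<theta>) \<theta> < 0"
    and C: "(deriv ^^ 3) (R \<theta>) \<theta> / (deriv ^^ 2) (R \<theta>) \<theta> = C / \<theta>"
    using assms by (auto simp: regular_reward_def valid_def)
  have r3: "(deriv ^^ 3) (R \<theta>) \<theta> = C * (deriv ^^ 2) (R \<theta>) \<theta> / \<theta>"
    using \<theta> C by (simp add: field_simps)
  have "scaled_improvement (R \<theta>) P T l \<longlonglongrightarrow> (deriv ^^ 2) (R \<theta>) \<theta> / 2 * (l * \<theta>)\<^sup>2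
      + l * (2 * ((deriv ^^ 2) (R \<theta>) \<theta> / 2) + 3 * ((deriv ^^ 3) (R \<theta>) \<theta> / 6) * \<theta>) * \<sigma>\<^sup>2" for l
    by (rule scaled_improvement_tendsto[where D = "D \<theta>"])
      (use assms in \<open>auto simp: regular_reward_def valid_def\<close>)
  from this[of "k * \<sigma>\<^sup>2 / \<theta>\<^sup>2"] show ?thesis
    unfolding r3 using \<theta>(1)
    by (elim back_subst[where P = "\<lambda>x. _ \<longlonglongrightarrow> x"]) (simp add: field_simps eval_nat_numeral)
qed

text \<open>The leading coefficient \<open>a\<close> is negative, so maximizing means minimizing the
  square. Its zero depends on \<open>C\<close> alone and is therefore the same for all valid
  parameters.\<close>

lemma valid_maximizes_improvement_iff:
  assumes "regular_reward Th D R C" and "valid Th D R \<theta> \<sigma> P T"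
  shows "maximizes_improvement (R \<theta>) \<theta> \<sigma> P T k \<longleftrightarrow> k = - (C + 2) / 2"
proof -
  define a where "a = (deriv ^^ 2) (R \<theta>) \<theta> * \<sigma> ^ 4 / (2 * \<theta>\<^sup>2)"
  have "\<theta> \<noteq> 0" "(deriv ^^ 2) (R \<theta>) \<theta> < 0" "\<sigma> > 0"
    using assms by (auto simp: regular_reward_def valid_def estimator_sequence_def)
  then have a: "a < 0"
    by (simp add: a_def divide_neg_pos mult_neg_pos)
  note lim = valid_scaled_improvement_tendsto[OF assms, folded a_def]
  have "is_arg_max (\<lambda>k. a * ((k + (C + 2) / 2)\<^sup>2 - ((C + 2) / 2)\<^sup>2)) (\<lambda>_. True) k
      \<longleftrightarrow> (\<forall>k'. (k + (C + 2) / 2)\<^sup>2 \<le> (k' + (C + 2) / 2)\<^sup>2)"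
    using a by (simp add: is_arg_max_linorder mult_le_cancel_left)
  also have "\<dots> \<longleftrightarrow> (k + (C + 2) / 2)\<^sup>2 \<le> 0"
  proof
    assume "\<forall>k'. (k + (C + 2) / 2)\<^sup>2 \<le> (k' + (C + 2) / 2)\<^sup>2"
    \<comment> \<open>The vertex itself is the competitor that forces the square to vanish.\<close>
    from this[rule_format, of "- ((C + 2) / 2)"] show "(k + (C + 2) / 2)\<^sup>2 \<le> 0" by simp
  next
    assume "(k + (C + 2) / 2)\<^sup>2 \<le> 0"
    then show "\<forall>k'. (k + (C + 2) / 2)\<^sup>2 \<le> (k' + (C + 2) / 2)\<^sup>2"
      by (meson order_trans zero_le_power2)
  qed
  also have "\<dots> \<longleftrightarrow> k = - (C + 2) / 2"
    unfolding power2_less_eq_zero_iff by (simp add: field_simps, linarith)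
  finally show ?thesis
    using lim by (simp add: maximizes_improvement_def limI[OF lim] convergentI[OF lim])
qed

theorem proposition2:
  fixes Th :: "real set" and D :: "real \<Rightarrow> real set" and R :: "real \<Rightarrow> real \<Rightarrow> real"
    and C \<theta> \<sigma> lam :: real
    and P :: "nat \<Rightarrow> 'w measure" and T :: "nat \<Rightarrow> 'w \<Rightarrow> real"
  assumes "regular_reward Th D R C"
    and "valid Th D R \<theta> \<sigma> P T"
    and "lam = - ((C + 2) * \<sigma>\<^sup>2) / (2 * \<theta>\<^sup>2)"
  shows "(\<forall>l. \<forall>\<^sub>F n in sequentially. integrable (P n) (\<lambda>\<omega>. R \<theta> (T n \<omega> * (1 + l / real n))))
    \<and> scaled_improvement (R \<theta>) P T lam
        \<longlonglongrightarrow> - ((deriv ^^ 2) (R \<theta>) \<theta> * (C + 2)\<^sup>2 * \<sigma> ^ 4) / (8 * \<theta>\<^sup>2)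
    \<and> - ((deriv ^^ 2) (R \<theta>) \<theta> * (C + 2)\<^sup>2 * \<sigma> ^ 4) / (8 * \<theta>\<^sup>2) \<ge> 0
    \<and> (\<forall>k. maximizes_improvement (R \<theta>) \<theta> \<sigma> P T k \<longleftrightarrow> k = - (C + 2) / 2)
    \<and> (\<forall>k. (\<forall>\<theta>' \<sigma>' (P' :: nat \<Rightarrow> 'w measure) T'. valid Th D R \<theta>' \<sigma>' P' T' \<longrightarrow>
               maximizes_improvement (R \<theta>') \<theta>' \<sigma>' P' T' k)
           \<longleftrightarrow> k = - (C + 2) / 2)"
proof (intro conjI allI)
  have \<theta>: "\<theta> \<noteq> 0" "(deriv ^^ 2) (R \<theta>) \<theta> < 0"
    using assms by (auto simp: regular_reward_def valid_def)
  show "\<forall>\<^sub>F n in sequentially. integrable (P n) (\<lambda>\<omega>. R \<theta> (T n \<omega> * (1 + l / real n)))" for l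
    by (rule integrable_adjusted_reward[where D = "D \<theta>" and \<theta> = \<theta> and \<sigma> = \<sigma>])
      (use assms(1,2) in \<open>auto simp: regular_reward_def valid_def\<close>)
  \<comment> \<open>\<open>lam\<close> corresponds to the vertex, where the first square is 0 and
    only the constant of the completed square is left.\<close>
  have "lam = (- (C + 2) / 2) * \<sigma>\<^sup>2 / \<theta>\<^sup>2"
    unfolding assms(3) by (simp add: field_simps)
  moreover have zero: "- (C + 2) / 2 + (C + 2) / 2 = 0"
    by linarith
  have "(deriv ^^ 2) (R \<theta>) \<theta> * \<sigma> ^ 4 / (2 * \<theta>\<^sup>2) * ((- (C + 2) / 2 + (C + 2) / 2)\<^sup>2 - ((C + 2) / 2)\<^sup>2)
      = - ((deriv ^^ 2) (R \<theta>) \<theta> * (C + 2)\<^sup>2 * \<sigma> ^ 4) / (8 * \<theta>\<^sup>2)"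
    unfolding zero by (simp add: power_divide)
  ultimately show "scaled_improvement (R \<theta>) P T lam
        \<longlonglongrightarrow> - ((deriv ^^ 2) (R \<theta>) \<theta> * (C + 2)\<^sup>2 * \<sigma> ^ 4) / (8 * \<theta>\<^sup>2)"
    using valid_scaled_improvement_tendsto[OF assms(1,2), of "- (C + 2) / 2"] by simp
  show "- ((deriv ^^ 2) (R \<theta>) \<theta> * (C + 2)\<^sup>2 * \<sigma> ^ 4) / (8 * \<theta>\<^sup>2) \<ge> 0"
    using \<theta>(2) by (intro divide_nonneg_nonneg) (auto simp: mult_nonpos_nonneg)
  show "maximizes_improvement (R \<theta>) \<theta> \<sigma> P T k \<longleftrightarrow> k = - (C + 2) / 2" for k
    by (rule valid_maximizes_improvement_iff[OF assms(1,2)])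
  show "(\<forall>\<theta>' \<sigma>' (P' :: nat \<Rightarrow> 'w measure) T'. valid Th D R \<theta>' \<sigma>' P' T' \<longrightarrow>
               maximizes_improvement (R \<theta>') \<theta>' \<sigma>' P' T' k)
           \<longleftrightarrow> k = - (C + 2) / 2" for k
    \<comment> \<open>The given valid instance forces the value of \<open>k\<close>; conversely this
      value is optimal in every valid instance.\<close>
    using valid_maximizes_improvement_iff[OF assms(1)] assms(2) by blast
qed

end
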